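(* Let $b\in\{0,\pm1,\pm\frac12\}$, and for a positive integer $n$ let $f_n(x)=2T_n\left(\frac x2+b\right)-2b$. Then the factorization of $f_n(x)$ in $\mathbb{Z}[x]$ is given as follows (products over positive divisors $k$ of $n$ satisfying the indicated conditions): (1) in case $b=0$: $\displaystyle f_n(x)=\prod_{k\mid n,\ \gcd(n/k,2)=1}\Psi_{4k}(x)$; (2) in case $b=1$: $\displaystyle f_n(x)=c_n(x)\prod_{k\mid n,\ 2<k}\Psi_k(x+2)^2$; (3) in case $b=-1$: $\displaystyle f_n(x)=c^*_n(x)\prod_{k\mid n,\ 1<k,\ \gcd(n/k,2)=1}\Psi_{2k}(x-2)^2$; (4) in case $b=\frac12$: $\displaystyle f_n(x)=\prod_{k\mid n,\ \gcd(n/k,6)=1}\Psi_{6k}(x+1)$; (5) in case $b=-\frac12$: $\displaystyle f_n(x)=\prod_{k\mid n,\ \gcd(n/k,3)=1}\Psi_{3k}(x-1)$.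
   Context: $T_n$ is the Chebyshev polynomial of the first kind: $T_0=1$, $T_1=x$, $T_n=2xT_{n-1}-T_{n-2}$ for $n\ge2$. For a positive integer $n$, $\Psi_n(x)$ denotes the (monic) minimal polynomial over $\mathbb{Q}$ of $2\cos\left(\frac{2\pi}{n}\right)$, which has integer coefficients. Further, $c_n(x)=x$ if $n$ is odd and $c_n(x)=x(x+4)$ if $n$ is even; $c^*_n(x)=x$ if $n$ is odd and $c^*_n(x)=1$ if $n$ is even. *)

theory Defs
  imports Complex_Main "HOL-Computational_Algebra.Computational_Algebra"
begin

fun chebyshev_T :: "nat \<Rightarrow> rat poly" where
  "chebyshev_T 0 = 1"
| "chebyshev_T (Suc 0) = [:0, 1:]"
| "chebyshev_T (Suc (Suc n)) = 2 * [:0, 1:] * chebyshev_T (Suc n) - chebyshev_T n"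

text \<open>A real number \<open>\<alpha>\<close> has at most one monic annihilating polynomial of least degree
  over the rationals; for \<open>\<alpha>\<close> transcendental the value below is unspecified.\<close>

definition minimal_polynomial :: "real \<Rightarrow> rat poly" where
  "minimal_polynomial \<alpha> =
     (THE p. lead_coeff p = 1 \<and> poly (map_poly of_rat p) \<alpha> = 0 \<and>
             (\<forall>q. q \<noteq> 0 \<and> poly (map_poly of_rat q) \<alpha> = 0 \<longrightarrow> degree p \<le> degree q))"

text \<open>For \<open>n > 0\<close> the minimal polynomial of the algebraic integer \<open>2 cos (2\<pi>/n)\<close> has integer
  coefficients, and \<open>Psi n\<close> is that polynomial regarded as an element of \<open>\<int>[x]\<close>.\<close>

definition Psi :: "nat \<Rightarrow> int poly" where
  "Psi n = (THE p. map_poly of_int p = minimal_polynomial (2 * cos (2 * pi / real n)))"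

definition f :: "rat \<Rightarrow> nat \<Rightarrow> rat poly" where
  "f b n = 2 * (chebyshev_T n \<circ>\<^sub>p [:b, 1/2:]) - [:2 * b:]"

definition c :: "nat \<Rightarrow> int poly" where
  "c n = (if odd n then [:0, 1:] else [:0, 1:] * [:4, 1:])"

definition c_star :: "nat \<Rightarrow> int poly" where
  "c_star n = (if odd n then [:0, 1:] else 1)"

end

theory Submission
  imports Defs
begin

text \<open>With \<open>D n = 2 T n (x/2)\<close>, so that \<open>D n (2 cos \<theta>) = 2 cos (n \<theta>)\<close>, the polynomial \<open>f b n\<close> is
  \<open>D n - 2b\<close> evaluated at \<open>x + 2b\<close>. Its roots are \<open>2 cos\<close> of rational multiples of \<open>\<pi>\<close>,
  and the order of such an angle modulo \<open>2\<pi>\<close> decides which \<open>Psi m\<close> vanishes there: \<open>Psi m\<close> vanishes at all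
  \<open>2 cos (2\<pi>j/m)\<close> with \<open>j\<close> coprime to \<open>m\<close>. The factors on the right-hand side are powers of distinct primes
  of \<open>\<int>[x]\<close> dividing the monic polynomial on the left, so their product divides it; counting
  distinct roots shows that the product already has degree \<open>n\<close>. For \<open>b = \<plusminus>1\<close> the roots other than
  \<open>\<plusminus>2\<close> are critical points of \<open>D n\<close>, which produces the squares.\<close>

section \<open>Integral minimal polynomials of real numbers\<close>

lemma map_poly_of_int_add:
  "map_poly of_int (p + q) = (map_poly of_int p + map_poly of_int q :: 'a::ring_1 poly)"
  by (simp add: poly_eq_iff coeff_map_poly)

lemma map_poly_of_int_diff:
  "map_poly of_int (p - q) = (map_poly of_int p - map_poly of_int q :: 'a::ring_1 poly)"
  by (simp add: poly_eq_iff coeff_map_poly)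

lemma map_poly_of_int_smult:
  "map_poly of_int (smult a p) = (smult (of_int a) (map_poly of_int p) :: 'a::comm_ring_1 poly)"
  by (simp add: poly_eq_iff coeff_map_poly)

lemma map_poly_of_int_mult:
  "map_poly of_int (p * q) = (map_poly of_int p * map_poly of_int q :: 'a::comm_ring_1 poly)"
  by (simp add: poly_eq_iff coeff_map_poly coeff_mult)

lemma map_poly_of_int_pcompose:
  "map_poly of_int (p \<circ>\<^sub>p q) =
     (map_poly of_int p \<circ>\<^sub>p map_poly of_int q :: 'a::comm_ring_1 poly)"
  by (induction p) (simp_all add: pcompose_pCons map_poly_pCons map_poly_of_int_add
      map_poly_of_int_mult)

lemma map_poly_of_int_eq_iff:
  "map_poly of_int p = (map_poly of_int q :: 'a::ring_char_0 poly) \<longleftrightarrow> p = q"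
  by (simp add: poly_eq_iff coeff_map_poly)

lemma degree_map_poly_of_int: "degree (map_poly of_int p :: 'a::ring_char_0 poly) = degree p"
  by (simp add: degree_map_poly)

lemma map_poly_of_rat_of_int: "map_poly of_rat (map_poly of_int p) = (map_poly of_int p :: real poly)"
  by (simp add: poly_eq_iff coeff_map_poly)

definition ev :: "int poly \<Rightarrow> real \<Rightarrow> real" where
  "ev p x = poly (map_poly of_int p) x"

lemma ev_0 [simp]: "ev 0 x = 0"
  and ev_1 [simp]: "ev 1 x = 1"
  and ev_pCons [simp]: "ev (pCons a p) x = of_int a + x * ev p x"
  and ev_add [simp]: "ev (p + q) x = ev p x + ev q x"
  and ev_diff [simp]: "ev (p - q) x = ev p x - ev q x"
  and ev_smult [simp]: "ev (smult a p) x = of_int a * ev p x"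
  and ev_mult [simp]: "ev (p * q) x = ev p x * ev q x"
  by (simp_all add: ev_def map_poly_pCons map_poly_of_int_add map_poly_of_int_diff
      map_poly_of_int_smult map_poly_of_int_mult)

lemma ev_pcompose [simp]: "ev (p \<circ>\<^sub>p q) x = ev p (ev q x)"
  by (simp add: ev_def map_poly_of_int_pcompose poly_pcompose)

lemma ev_power [simp]: "ev (p ^ k) x = ev p x ^ k"
  by (induction k) simp_all

lemma ev_of_nat [simp]: "ev (of_nat k) x = of_nat k"
  by (simp add: of_nat_poly)

lemma ev_prod [simp]: "ev (\<Prod>i\<in>A. p i) x = (\<Prod>i\<in>A. ev (p i) x)"
  by (induction A rule: infinite_finite_induct) simp_all

lemma card_roots_ev_le:
  assumes "p \<noteq> 0"
  shows "finite {x. ev p x = 0}" "card {x. ev p x = 0} \<le> degree p"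
proof -
  have "(map_poly of_int p :: real poly) \<noteq> 0"
    using assms by (simp add: map_poly_eq_0_iff)
  from poly_roots_finite[OF this] card_poly_roots_bound[OF this]
  show "finite {x. ev p x = 0}" "card {x. ev p x = 0} \<le> degree p"
    by (simp_all add: ev_def degree_map_poly_of_int)
qed

text \<open>Each new coefficient multiplies the common denominator by its own. This turns a rational
  polynomial vanishing at a real number into an integer one of the same degree.\<close>

lemma rat_poly_common_denominator:
  fixes q :: "rat poly"
  obtains d :: int and q' :: "int poly" where "d > 0" "map_poly of_int q' = smult (of_int d) q"
proof -
  have "\<exists>d q'. d > 0 \<and> map_poly of_int q' = smult (of_int d) q"
  proof (induction q)
    case 0
    show ?case by (rule exI[of _ 1], rule exI[of _ 0]) simp
  next
    case (pCons a q)
    then obtain d q' where IH: "d > 0" "map_poly of_int q' = smult (of_int d) q" by blast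
    obtain u v :: int where uv: "a = of_int u / of_int v" "v > 0"
      by (metis quotient_of_div quotient_of_denom_pos surj_pair)
    have "map_poly of_int (pCons (d * u) (smult v q')) = smult (of_int (d * v)) (pCons a q)"
      using IH uv by (simp add: map_poly_pCons map_poly_of_int_smult mult.commute)
    moreover have "d * v > 0" using IH uv by simp
    ultimately show ?case by blast
  qed
  then show ?thesis using that by blast
qed

text \<open>Pseudo-division scales the dividend by a power of the leading coefficient of the
  divisor, here 1.\<close>

lemma monic_division_int_poly:
  fixes g p :: "int poly"
  assumes "lead_coeff g = 1"
  obtains q r where "p = g * q + r" "r = 0 \<or> degree r < degree g"
proof -
  obtain q r where qr: "pseudo_divmod p g = (q, r)" by force
  have "g \<noteq> 0" using assms by auto
  from pseudo_divmod[OF this qr] assms have "p = g * q + r" "r = 0 \<or> degree r < degree g"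
    by simp_all
  then show ?thesis by (rule that)
qed

text \<open>Only integer competitors are tested, so that divisibility arguments stay among integer
  polynomials; \<open>minimal_polynomial_eq\<close> takes care of the rational ones.\<close>

definition int_minpoly :: "int poly \<Rightarrow> real \<Rightarrow> bool" where
  "int_minpoly G x \<longleftrightarrow> lead_coeff G = 1 \<and> ev G x = 0 \<and>
     (\<forall>q. ev q x = 0 \<longrightarrow> q = 0 \<or> degree G \<le> degree q)"

text \<open>Gauss's lemma in disguise: a primitive polynomial of least degree annihilating \<open>x\<close> divides
  an integer multiple of the monic \<open>M\<close>, and multiplicativity of the content removes the
  multiple.\<close>

lemma int_minpoly_exists:
  assumes "lead_coeff M = 1" "ev M x = 0"
  obtains G where "int_minpoly G x"
proof -
  define P where "P q \<longleftrightarrow> q \<noteq> 0 \<and> ev q x = 0" for q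
  have "P M" using assms by (auto simp: P_def)
  then obtain F where F: "P F" "\<And>q. P q \<Longrightarrow> degree F \<le> degree q"
    using arg_min_nat_lemma[of P M degree] by blast
  define G where "G = primitive_part F"
  have F0: "F \<noteq> 0" using F by (simp add: P_def)
  have FG: "F = smult (content F) G" by (simp add: G_def)
  have ct0: "content F \<noteq> 0" using F0 by simp
  have evG: "ev G x = 0"
  proof -
    have "ev F x = of_int (content F) * ev G x" by (subst FG) simp
    then show ?thesis using F(1) ct0 by (metis P_def mult_eq_0_iff of_int_eq_0_iff)
  qed
  have degG: "degree G = degree F" by (simp add: G_def)
  have G0: "G \<noteq> 0" using F0 by (simp add: G_def)
  have contG: "content G = 1" using F0 by (simp add: G_def)
  obtain a q where aq: "a \<noteq> 0" "smult a M = G * q + pseudo_mod M G"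
    using pseudo_mod(1)[OF G0] by blast
  have r: "pseudo_mod M G = 0 \<or> degree (pseudo_mod M G) < degree G"
    by (rule pseudo_mod(2)[OF G0])
  have "ev (smult a M) x = ev (G * q + pseudo_mod M G) x" using aq(2) by simp
  then have "ev (pseudo_mod M G) x = 0" using assms evG by simp
  then have "pseudo_mod M G = 0" using r F(2) degG unfolding P_def by (metis not_le)
  with aq have aM: "smult a M = G * q" by simp
  \<comment> \<open>Contents are compared in \<open>smult a M = G * q\<close>: those of
    \<open>M\<close> and \<open>G\<close> are 1, so all of \<open>a\<close> sits in
    \<open>q\<close>.\<close>
  have "content M dvd lead_coeff M" by (rule content_dvd_coeff)
  then have "content M = 1"
    using assms(1) by (metis is_unit_content_iff)
  then have "normalize a = content q"
    using arg_cong[OF aM, of content] by (simp add: content_mult contG)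
  then have "a dvd content q" by (metis dvd_normalize_iff dvd_refl normalize_dvd_iff)
  then have "[:a:] dvd q" by (simp add: const_poly_dvd_iff_dvd_content)
  then obtain q' where q': "q = smult a q'" by (auto elim!: dvdE)
  have "smult a M = smult a (G * q')" using aM q' by simp
  then have M: "M = G * q'" using aq(1) by (simp only: smult_cancel) 
  \<comment> \<open>The leading coefficient of \<open>G\<close> is a unit, that is, a sign, and
    multiplying \<open>G\<close> by it makes \<open>G\<close> monic.\<close>
  have "lead_coeff G * lead_coeff q' = 1" using assms(1) M by (simp add: lead_coeff_mult)
  then have "lead_coeff G = 1 \<or> lead_coeff G = -1" by (metis zmult_eq_1_iff)
  then have "int_minpoly (smult (lead_coeff G) G) x"
    using evG F(2) degG G0 by (auto simp: int_minpoly_def P_def)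
  then show ?thesis by (rule that)
qed

text \<open>The remainder of \<open>q\<close> modulo the monic \<open>G\<close> vanishes at
  \<open>x\<close> too and has smaller degree, so minimality makes it 0.\<close>

lemma int_minpoly_dvd_iff:
  assumes "int_minpoly G x"
  shows "ev q x = 0 \<longleftrightarrow> G dvd q"
proof
  assume "G dvd q"
  then show "ev q x = 0" using assms by (auto simp: int_minpoly_def elim!: dvdE)
next
  assume q: "ev q x = 0"
  obtain s r where sr: "q = G * s + r" "r = 0 \<or> degree r < degree G"
    using monic_division_int_poly[of G q] assms unfolding int_minpoly_def by blast
  have "ev r x = 0" using q sr(1) assms by (simp add: int_minpoly_def)
  then have "r = 0" using sr(2) assms by (fastforce simp: int_minpoly_def)
  then show "G dvd q" using sr by simp
qed

text \<open>By \<open>int_minpoly_dvd_iff\<close> the multiples of \<open>G\<close> form the kernel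
  of evaluation at \<open>x\<close>, and the reals have no zero divisors.\<close>

lemma int_minpoly_prime_elem:
  assumes "int_minpoly G x"
  shows "prime_elem G"
proof (rule prime_elemI)
  show "G \<noteq> 0" using assms by (auto simp: int_minpoly_def)
  show "\<not> G dvd 1" using int_minpoly_dvd_iff[OF assms, of 1] by simp
  show "G dvd a \<or> G dvd b" if "G dvd a * b" for a b
    using that by (simp flip: int_minpoly_dvd_iff[OF assms])
qed

lemma int_minpoly_irreducible: "int_minpoly G x \<Longrightarrow> irreducible G"
  using int_minpoly_prime_elem prime_elem_imp_irreducible by blast

lemma int_minpoly_degree_pos:
  assumes "int_minpoly G x"
  shows "degree G > 0"
proof (rule ccontr)
  assume "\<not> degree G > 0"
  then obtain a where "G = [:a:]" by (auto elim: degree_eq_zeroE)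
  then show False using assms by (auto simp: int_minpoly_def)
qed

text \<open>The translation is invertible and preserves degrees, so a competitor of the shifted
  polynomial is carried back to one of \<open>G\<close>.\<close>

lemma int_minpoly_shift:
  assumes "int_minpoly G x"
  shows "int_minpoly (G \<circ>\<^sub>p [:a, 1:]) (x - of_int a)"
  unfolding int_minpoly_def
proof (intro conjI allI impI)
  show "lead_coeff (G \<circ>\<^sub>p [:a, 1:]) = 1"
    using assms by (simp add: lead_coeff_comp int_minpoly_def)
  show "ev (G \<circ>\<^sub>p [:a, 1:]) (x - of_int a) = 0"
    using assms by (simp add: int_minpoly_def)
  fix q assume q: "ev q (x - of_int a) = 0"
  then have "ev (q \<circ>\<^sub>p [:-a, 1:]) x = 0" by simp
  then have "q \<circ>\<^sub>p [:-a, 1:] = 0 \<or> degree G \<le> degree (q \<circ>\<^sub>p [:-a, 1:])"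
    using assms by (simp add: int_minpoly_def)
  then show "q = 0 \<or> degree (G \<circ>\<^sub>p [:a, 1:]) \<le> degree q"
    by (auto simp: degree_pcompose pcompose_eq_0_iff)
qed

text \<open>Clearing denominators extends minimality to rational competitors. Uniqueness holds
  because the difference of two monic candidates of equal degree has smaller degree and still
  vanishes at \<open>x\<close>.\<close>

lemma minimal_polynomial_eq:
  assumes G: "int_minpoly G x"
  shows "minimal_polynomial x = map_poly of_int G"
  unfolding minimal_polynomial_def
proof (rule the_equality)
  have minimal: "degree G \<le> degree q" if q: "q \<noteq> 0" "poly (map_poly of_rat q) x = 0" for q
  proof -
    obtain d q' where dq: "d > 0" "map_poly of_int q' = smult (of_int d) q"
      by (rule rat_poly_common_denominator)
    have "map_poly of_int q' = (map_poly of_rat (smult (of_int d) q) :: real poly)"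
      by (simp add: map_poly_of_rat_of_int flip: dq(2))
    also have "\<dots> = smult (of_int d) (map_poly of_rat q)"
      by (simp add: poly_eq_iff coeff_map_poly of_rat_mult)
    finally have "ev q' x = 0" using q by (simp add: ev_def)
    moreover have "degree q' = degree q"
      using arg_cong[OF dq(2), of degree] dq(1) by (simp add: degree_map_poly_of_int)
    moreover have "q' \<noteq> 0" using dq q by auto
    ultimately show ?thesis using G by (auto simp: int_minpoly_def)
  qed
  have lead: "lead_coeff (map_poly of_int G :: rat poly) = 1"
    using G by (subst lead_coeff_map_poly_nz) (auto simp: int_minpoly_def)
  have root: "poly (map_poly of_rat (map_poly of_int G :: rat poly)) x = 0"
    using G by (simp add: map_poly_of_rat_of_int int_minpoly_def ev_def)
  show "lead_coeff (map_poly of_int G :: rat poly) = 1 \<and>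
    poly (map_poly of_rat (map_poly of_int G :: rat poly)) x = 0 \<and>
    (\<forall>q. q \<noteq> 0 \<and> poly (map_poly of_rat q) x = 0 \<longrightarrow>
         degree (map_poly of_int G :: rat poly) \<le> degree q)"
    using lead root minimal by (auto simp: degree_map_poly_of_int)
  fix p :: "rat poly"
  assume p: "lead_coeff p = 1 \<and> poly (map_poly of_rat p) x = 0 \<and>
    (\<forall>q. q \<noteq> 0 \<and> poly (map_poly of_rat q) x = 0 \<longrightarrow> degree p \<le> degree q)"
  show "p = map_poly of_int G"
  proof (rule ccontr)
    define h where "h = p - map_poly of_int G"
    assume "p \<noteq> map_poly of_int G"
    then have "h \<noteq> 0" by (simp add: h_def)
    have degp: "degree p = degree G"
    proof (rule antisym)
      have "(map_poly of_int G :: rat poly) \<noteq> 0" using lead by force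
      then show "degree p \<le> degree G" using p root by (metis degree_map_poly_of_int)
      have "p \<noteq> 0" using p by force
      then show "degree G \<le> degree p" using p by (intro minimal) auto
    qed
    have "map_poly of_rat h = (map_poly of_rat p - map_poly of_int G :: real poly)"
      by (simp add: h_def poly_eq_iff coeff_map_poly of_rat_diff)
    then have "poly (map_poly of_rat h) x = 0"
      using p G by (simp add: int_minpoly_def ev_def)
    then have "degree G \<le> degree h" by (intro minimal \<open>h \<noteq> 0\<close>)
    moreover have "coeff h (degree G) = 0"
      using p G degp by (simp add: h_def coeff_map_poly int_minpoly_def)
    moreover have "degree h \<le> degree G"
      unfolding h_def using degp by (intro degree_diff_le) (simp_all add: degree_map_poly_of_int)
    ultimately show False using \<open>h \<noteq> 0\<close> by (metis antisym leading_coeff_0_iff)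
  qed
qed

section \<open>Dickson polynomials\<close>

text \<open>The rescaled Chebyshev polynomials have integer coefficients and, from index 1 on,
  leading coefficient 1. The constant 2 at index 0 is 2 cos 0.\<close>

fun dickson :: "nat \<Rightarrow> int poly" where
  "dickson 0 = [:2:]"
| "dickson (Suc 0) = [:0, 1:]"
| "dickson (Suc (Suc n)) = [:0, 1:] * dickson (Suc n) - dickson n"

lemma map_poly_dickson: "map_poly of_int (dickson n) = 2 * (chebyshev_T n \<circ>\<^sub>p [:0, 1/2:])"
proof (induction n rule: dickson.induct)
  case (3 n)
  have "2 * (chebyshev_T (Suc (Suc n)) \<circ>\<^sub>p [:0, 1/2:]) =
    (2 * [:0, 1/2:]) * (2 * (chebyshev_T (Suc n) \<circ>\<^sub>p [:0, 1/2:])) - 2 * (chebyshev_T n \<circ>\<^sub>p [:0, 1/2:])"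
    by (simp add: pcompose_diff pcompose_mult pcompose_pCons pcompose_smult numeral_poly algebra_simps)
  also have "2 * [:0, 1/2 :: rat:] = [:0, 1:]" by (simp add: numeral_poly)
  finally show ?case using 3
    by (simp only: dickson.simps map_poly_of_int_diff map_poly_of_int_mult) (simp add: map_poly_pCons)
qed (simp_all add: map_poly_pCons numeral_poly pcompose_pCons pcompose_1)

text \<open>Since x/2 + b = (x + 2b)/2, the argument is a translate by \<open>t\<close> of the one
  in \<open>map_poly_dickson\<close>. All five values of \<open>b\<close> make 2b an
  integer.\<close>

lemma f_eq_dickson:
  assumes "2 * b = of_int t"
  shows "f b n = map_poly of_int ((dickson n - [:t:]) \<circ>\<^sub>p [:t, 1:])"
proof -
  have "[:0, 1/2:] \<circ>\<^sub>p [:of_int t, 1:] = [:b, 1/2:]"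
    by (simp add: pcompose_pCons flip: assms)
  then have "chebyshev_T n \<circ>\<^sub>p [:b, 1/2:] = chebyshev_T n \<circ>\<^sub>p [:0, 1/2:] \<circ>\<^sub>p [:of_int t, 1:]"
    by (simp flip: pcompose_assoc)
  then show ?thesis
    by (simp add: f_def assms map_poly_of_int_pcompose map_poly_of_int_diff map_poly_dickson
        map_poly_pCons pcompose_diff pcompose_mult numeral_poly pcompose_smult)
qed

lemma degree_dickson: "degree (dickson n) = n"
  and lead_coeff_dickson: "n > 0 \<Longrightarrow> coeff (dickson n) n = 1"
proof -
  have "degree (dickson n) \<le> n \<and> coeff (dickson n) n = (if n = 0 then 2 else 1)"
  proof (induction n rule: dickson.induct)
    case (3 n)
    have "degree ([:0, 1:] * dickson (Suc n)) \<le> Suc (Suc n)"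
      using 3 degree_mult_le[of "[:0, 1:]" "dickson (Suc n)"] by simp
    moreover have "degree (dickson n) \<le> Suc (Suc n)" using 3 by simp
    moreover have "coeff (dickson n) (Suc (Suc n)) = 0" using 3 by (simp add: coeff_eq_0)
    ultimately show ?case using 3 by (simp add: degree_diff_le)
  qed simp_all
  then show "degree (dickson n) = n" "n > 0 \<Longrightarrow> coeff (dickson n) n = 1"
    by (auto intro!: antisym le_degree split: if_splits)
qed

lemma ev_dickson: "ev (dickson n) (2 * cos t) = 2 * cos (real n * t)"
proof (induction n rule: dickson.induct)
  case (3 n)
  have "cos (real (Suc n) * t + t) + cos (real (Suc n) * t - t) = 2 * cos (real (Suc n) * t) * cos t"
    by (simp add: cos_add cos_diff)
  moreover have "real (Suc n) * t + t = real (Suc (Suc n)) * t" "real (Suc n) * t - t = real n * t"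
    by (simp_all add: algebra_simps)
  ultimately have "2 * (2 * cos (real (Suc n) * t) * cos t) =
      2 * cos (real (Suc (Suc n)) * t) + 2 * cos (real n * t)"
    by (simp only: distrib_left)
  with 3 show ?case by (simp del: of_nat_Suc add: algebra_simps)
qed simp_all

text \<open>This is \<open>ev_dickson\<close> differentiated in \<open>t\<close>; it later detects
  the multiple roots behind the squared factors.\<close>

lemma ev_pderiv_dickson:
  "ev (pderiv (dickson n)) (2 * cos t) * sin t = real n * sin (real n * t)"
proof -
  have pd: "map_poly of_int (pderiv p) = pderiv (map_poly of_int p :: real poly)" for p
    by (simp add: poly_eq_iff coeff_map_poly coeff_pderiv)
  have "((\<lambda>s. ev (dickson n) (2 * cos s)) has_real_derivative
      ev (pderiv (dickson n)) (2 * cos t) * (2 * (- sin t))) (at t)"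
    unfolding ev_def pd by (rule derivative_eq_intros DERIV_chain2[OF poly_DERIV] refl | simp)+
  moreover have "((\<lambda>s. 2 * cos (real n * s)) has_real_derivative
      2 * (- sin (real n * t) * real n)) (at t)"
    by (auto intro!: derivative_eq_intros)
  ultimately have "ev (pderiv (dickson n)) (2 * cos t) * (2 * (- sin t)) =
      2 * (- sin (real n * t) * real n)"
    unfolding ev_dickson by (rule DERIV_unique)
  then show ?thesis by (simp add: mult.commute)
qed

section \<open>Dickson polynomials modulo an odd prime\<close>

lemma sum_Suc_choose:
  fixes F :: "nat \<Rightarrow> 'a::comm_semiring_1"
  shows "(\<Sum>i\<le>Suc n. of_nat (Suc n choose i) * F i) =
    (\<Sum>i\<le>n. of_nat (n choose i) * (F i + F (Suc i)))"
proof -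
  have "(\<Sum>i\<le>Suc n. of_nat (Suc n choose i) * F i) =
      F 0 + (\<Sum>i\<le>n. of_nat ((n choose Suc i) + (n choose i)) * F (Suc i))"
    by (subst sum.atMost_Suc_shift) (simp add: add.commute)
  also have "\<dots> = (F 0 + (\<Sum>i\<le>n. of_nat (n choose Suc i) * F (Suc i))) +
      (\<Sum>i\<le>n. of_nat (n choose i) * F (Suc i))"
    by (simp add: distrib_right sum.distrib add.assoc)
  also have "F 0 + (\<Sum>i\<le>n. of_nat (n choose Suc i) * F (Suc i)) =
      (\<Sum>i\<le>Suc n. of_nat (n choose i) * F i)"
    by (subst sum.atMost_Suc_shift) simp
  also have "\<dots> = (\<Sum>i\<le>n. of_nat (n choose i) * F i)"
    by (simp add: binomial_eq_0)
  finally show ?thesis by (simp add: sum.distrib distrib_left)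
qed

text \<open>Absolute values extend the recursion symmetrically to negative indices; at index 0 it
  says that X times 2 is X + X. The binomial sum below then needs no case split.\<close>

lemma X_mult_dickson:
  "[:0, 1:] * dickson (nat \<bar>k\<bar>) = dickson (nat \<bar>k + 1\<bar>) + dickson (nat \<bar>k - 1\<bar>)" for k :: int
proof -
  have pos: "[:0, 1:] * dickson (nat \<bar>k\<bar>) = dickson (nat \<bar>k + 1\<bar>) + dickson (nat \<bar>k - 1\<bar>)"
    if "k > 0" for k :: int
  proof -
    define m where "m = nat (k - 1)"
    have "nat \<bar>k\<bar> = Suc m" "nat \<bar>k + 1\<bar> = Suc (Suc m)" "nat \<bar>k - 1\<bar> = m"
      using that by (simp_all add: m_def)
    then show ?thesis by (simp only: dickson.simps diff_add_cancel)
  qed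
  consider "k > 0" | "k = 0" | "- k > 0" by linarith
  then show ?thesis
  proof cases
    case 3
    have "\<bar>- k + 1\<bar> = \<bar>k - 1\<bar>" "\<bar>- k - 1\<bar> = \<bar>k + 1\<bar>" by linarith+
    with pos[OF 3] show ?thesis by simp
  qed (rule pos, assumption, simp)
qed

text \<open>With X = z + 1/z and \<open>dickson k\<close> = z^k + z^(-k) this is the binomial
  theorem, symmetrized under z to 1/z, hence the factor 2. The induction multiplies by X and
  recombines terms by Pascal's rule.\<close>

lemma X_power_dickson:
  "2 * [:0, 1:] ^ n = (\<Sum>i\<le>n. of_nat (n choose i) * dickson (nat \<bar>int n - 2 * int i\<bar>))"
proof (induction n)
  case (Suc n)
  have "2 * [:0, 1 :: int:] ^ Suc n = [:0, 1:] * (2 * [:0, 1:] ^ n)"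
    by (simp only: power_Suc mult.left_commute)
  also have "\<dots> = (\<Sum>i\<le>n. of_nat (n choose i) * ([:0, 1:] * dickson (nat \<bar>int n - 2 * int i\<bar>)))"
    by (simp only: Suc sum_distrib_left mult.left_commute)
  also have "\<dots> = (\<Sum>i\<le>n. of_nat (n choose i) *
      (dickson (nat \<bar>int (Suc n) - 2 * int i\<bar>) + dickson (nat \<bar>int (Suc n) - 2 * int (Suc i)\<bar>)))"
    by (rule sum.cong) (simp_all only: X_mult_dickson, simp_all add: algebra_simps)
  finally show ?case by (simp only: sum_Suc_choose)
qed (simp add: numeral_poly)

lemma of_nat_dvd_mono: "m dvd n \<Longrightarrow> of_nat m dvd (of_nat n :: 'a::comm_semiring_1)"
  by (auto elim!: dvdE)

text \<open>Both end terms of the expansion equal \<open>dickson p\<close>, and all inner binomial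
  coefficients are divisible by \<open>p\<close>; the factor 2 is then removed.\<close>

lemma prime_dvd_dickson_diff_power:
  assumes "prime p" "p > 2"
  shows "of_nat p dvd dickson p - [:0, 1:] ^ p"
proof -
  define F where "F i = dickson (nat \<bar>int p - 2 * int i\<bar>)" for i
  have "2 * [:0, 1:] ^ p = (\<Sum>i\<le>p. of_nat (p choose i) * F i)"
    unfolding F_def by (rule X_power_dickson)
  also have "\<dots> = F 0 + F p + (\<Sum>i\<in>{1..<p}. of_nat (p choose i) * F i)"
  proof -
    have "{..p} = insert 0 (insert p {1..<p})" using assms(2) by auto
    then show ?thesis using assms(2) by simp
  qed
  finally have "2 * (dickson p - [:0, 1:] ^ p) = - (\<Sum>i\<in>{1..<p}. of_nat (p choose i) * F i)"
    by (simp add: F_def algebra_simps)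
  moreover have "of_nat p dvd (\<Sum>i\<in>{1..<p}. of_nat (p choose i) * F i)"
    by (intro dvd_sum dvd_mult2 of_nat_dvd_mono dvd_choose_prime) (use assms in simp_all)
  ultimately have dvd: "of_nat p dvd 2 * (dickson p - [:0, 1:] ^ p)" by simp
  have "odd p" using assms prime_odd_nat by auto
  then obtain k where k: "p = 2 * k + 1" using oddE by blast
  \<comment> \<open>As p = 2k + 1, the integer -k inverts 2 modulo \<open>p\<close>.\<close>
  have "y = of_nat p * y - of_nat k * (2 * y)" for y :: "int poly"
    unfolding k by (simp add: algebra_simps)
  from this[of "dickson p - [:0, 1:] ^ p"] show ?thesis
    using dvd by (metis dvd_diff dvd_mult dvd_triv_left)
qed

lemma prime_dvd_power_add_diff:
  fixes a b :: "'a::comm_ring_1"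
  assumes "prime p"
  shows "of_nat p dvd (a + b) ^ p - (a ^ p + b ^ p)"
proof -
  have "p > 0" using assms prime_gt_0_nat by blast
  have "(a + b) ^ p = (\<Sum>i\<le>p. of_nat (p choose i) * a ^ i * b ^ (p - i))" by (rule binomial_ring)
  also have "{..p} = insert 0 (insert p {1..<p})" using \<open>p > 0\<close> by auto
  finally have "(a + b) ^ p - (a ^ p + b ^ p) = (\<Sum>i\<in>{1..<p}. of_nat (p choose i) * a ^ i * b ^ (p - i))"
    using \<open>p > 0\<close> by simp
  also have "of_nat p dvd \<dots>"
    by (intro dvd_sum dvd_mult2 of_nat_dvd_mono dvd_choose_prime) (use assms in auto)
  finally show ?thesis .
qed

text \<open>Fermat's little theorem: induction with the binomial congruence treats nonnegative
  bases, and reduction modulo \<open>p\<close> gives the others.\<close>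

lemma prime_dvd_power_diff_int:
  fixes a :: int
  assumes "prime p"
  shows "int p dvd a ^ p - a"
proof -
  have "p > 0" using assms prime_gt_0_nat by blast
  have nonneg: "int p dvd int k ^ p - int k" for k
  proof (induction k)
    case 0
    then show ?case using \<open>p > 0\<close> by (simp add: zero_power)
  next
    case (Suc k)
    have "int (Suc k) ^ p - int (Suc k) = ((int k + 1) ^ p - (int k ^ p + 1 ^ p)) + (int k ^ p - int k)"
      by (simp add: add.commute)
    also have "int p dvd \<dots>"
      using prime_dvd_power_add_diff[OF assms, of "int k" 1] Suc by (rule dvd_add)
    finally show ?case .
  qed
  have "int p dvd (a mod int p) ^ p - a mod int p"
    using nonneg[of "nat (a mod int p)"] \<open>p > 0\<close> by simp
  then have "((a mod int p) ^ p - a mod int p) mod int p = 0" by (rule dvd_imp_mod_0)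
  then have "(a ^ p - a) mod int p = 0" by (metis mod_diff_eq power_mod mod_mod_trivial)
  then show ?thesis by (rule mod_0_imp_dvd)
qed

text \<open>Modulo \<open>p\<close> the Frobenius map gives G(X)^p = G(X^p), by Fermat and the
  binomial congruence, and X^p may be replaced by \<open>dickson p\<close>. The induction follows
  Horner's scheme.\<close>

lemma prime_dvd_pcompose_dickson_diff_power:
  assumes "prime p" "p > 2"
  shows "of_nat p dvd G \<circ>\<^sub>p dickson p - G ^ p"
proof (induction G)
  case 0
  then show ?case using assms by (simp add: zero_power)
next
  case (pCons a G)
  define X :: "int poly" where "X = [:0, 1:]"
  obtain d where d: "a ^ p - a = int p * d" using prime_dvd_power_diff_int[OF assms(1)] by (auto elim: dvdE)
  have "[:a:] - [:a:] ^ p = of_nat p * [:- d:]"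
    using d by (simp add: of_nat_poly poly_const_pow algebra_simps)
  then have 1: "of_nat p dvd [:a:] - [:a:] ^ p" by (rule dvdI)
  have 2: "of_nat p dvd dickson p * (G \<circ>\<^sub>p dickson p - G ^ p)" using pCons by simp
  have 3: "of_nat p dvd (dickson p - X ^ p) * G ^ p"
    using prime_dvd_dickson_diff_power[OF assms] by (simp add: X_def)
  have 4: "of_nat p dvd ([:a:] + X * G) ^ p - ([:a:] ^ p + (X * G) ^ p)"
    by (rule prime_dvd_power_add_diff[OF assms(1)])
  have aG: "pCons a G = [:a:] + X * G" by (simp add: X_def)
  \<comment> \<open>The difference splits into four errors: Fermat for the constant, the induction
    hypothesis, the replacement of \<open>X ^ p\<close>, and the expansion of the power.\<close>
  have "pCons a G \<circ>\<^sub>p dickson p - pCons a G ^ p =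
     (([:a:] - [:a:] ^ p) + dickson p * (G \<circ>\<^sub>p dickson p - G ^ p) + (dickson p - X ^ p) * G ^ p)
      - (([:a:] + X * G) ^ p - ([:a:] ^ p + (X * G) ^ p))"
    unfolding aG[symmetric] by (simp add: pcompose_pCons power_mult_distrib algebra_simps)
  also have "of_nat p dvd \<dots>"
    by (rule dvd_diff[OF dvd_add[OF dvd_add[OF 1 2] 3] 4])
  finally show ?case .
qed

section \<open>The polynomials \<open>Psi n\<close> and their roots\<close>

lemma cos_two_pi_frac_add:
  assumes "n > 0"
  shows "cos (2 * pi * real (j + n * m) / real n) = cos (2 * pi * real j / real n)"
proof -
  have "2 * pi * real (j + n * m) / real n = 2 * pi * real j / real n + 2 * real m * pi"
    using assms by (simp add: field_simps)
  then show ?thesis by (simp only: cos_add cos_2npi sin_2npi)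
qed

lemma cos_two_pi_frac_mod:
  assumes "n > 0"
  shows "cos (2 * pi * real (j mod n) / real n) = cos (2 * pi * real j / real n)"
  using cos_two_pi_frac_add[OF assms, of "j mod n" "j div n"] by simp

lemma cos_two_pi_frac_eq_1:
  assumes "m > 0" "cos (2 * pi * real n / real m) = 1"
  shows "m dvd n"
proof -
  obtain k :: int where "2 * pi * real n / real m = of_int k * 2 * pi"
    using assms(2) cos_one_2pi_int by blast
  then have "real n = of_int k * real m" using assms(1) by (simp add: field_simps)
  then have "real_of_int (int n) = real_of_int (k * int m)" by simp
  then have "int n = k * int m" by (simp only: of_int_eq_iff)
  then show ?thesis by (metis dvd_triv_right int_dvd_int_iff)
qed

lemma ev_dickson_two_pi_frac:
  "ev (dickson n) (2 * cos (2 * pi * real j / real m)) = 2 * cos (2 * pi * real (n * j) / real m)"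
  unfolding ev_dickson by (simp add: mult.commute mult.left_commute)

lemma lead_coeff_dickson_diff:
  assumes "n > 0"
  shows "degree (dickson n - [:t:]) = n" "lead_coeff (dickson n - [:t:]) = 1"
proof -
  have 1: "coeff (dickson n - [:t:]) n = 1"
    using assms lead_coeff_dickson[of n] by (cases n) simp_all
  have "degree (dickson n - [:t:]) \<le> n" by (intro degree_diff_le) (simp_all add: degree_dickson)
  with 1 show "degree (dickson n - [:t:]) = n" by (simp add: antisym le_degree)
  with 1 show "lead_coeff (dickson n - [:t:]) = 1" by simp
qed

text \<open>\<open>dickson n - [:2:]\<close> is monic and vanishes at this number, so a monic
  integer minimal polynomial exists; by uniqueness both definite descriptions then denote
  it.\<close>

lemma int_minpoly_Psi:
  assumes "n > 0"
  shows "int_minpoly (Psi n) (2 * cos (2 * pi / real n))"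
proof -
  have "ev (dickson n - [:2:]) (2 * cos (2 * pi / real n)) = 0"
    using assms by (simp add: ev_dickson)
  then obtain G where G: "int_minpoly G (2 * cos (2 * pi / real n))"
    using int_minpoly_exists lead_coeff_dickson_diff(2)[OF assms] by blast
  have "Psi n = G"
    unfolding Psi_def minimal_polynomial_eq[OF G] by (simp add: map_poly_of_int_eq_iff)
  with G show ?thesis by simp
qed

text \<open>Landau's argument: the value of \<open>G \<circ> dickson p\<close> at \<open>2 cos (2\<pi>/n)\<close> depends only on
  \<open>p mod n\<close>, while \<open>G \<circ> dickson p \<equiv> G ^ p\<close> modulo \<open>p\<close> makes its reduced representative
  divisible by \<open>p\<close>; the finitely many representatives have bounded coefficients.\<close>

lemma minpoly_dvd_pcompose_dickson_large_prime:
  assumes n: "n > 0" and G: "int_minpoly G (2 * cos (2 * pi / real n))"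
  obtains A where "\<And>p. prime p \<Longrightarrow> p > A \<Longrightarrow> G dvd G \<circ>\<^sub>p dickson p"
proof -
  define \<alpha> where "\<alpha> = 2 * cos (2 * pi / real n)"
  note G = G[folded \<alpha>_def]
  have lead: "lead_coeff G = 1" and root: "ev G \<alpha> = 0" using G by (simp_all add: int_minpoly_def)
  define V where "V p = ev (G \<circ>\<^sub>p dickson p) \<alpha>" for p
  have V_mod: "V (p mod n) = V p" for p
    using ev_dickson_two_pi_frac[of _ 1 n] cos_two_pi_frac_mod[OF n]
    by (simp add: V_def \<alpha>_def)
  have "\<exists>A. \<forall>p. prime p \<longrightarrow> p > A \<longrightarrow> p mod n = k \<longrightarrow> V p = 0" for k
  proof -
    obtain q r where qr: "G \<circ>\<^sub>p dickson k = G * q + r" "r = 0 \<or> degree r < degree G"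
      using monic_division_int_poly[OF lead] by blast
    have Vk: "V k = ev r \<alpha>" using qr(1) root by (simp add: V_def)
    have "V p = 0" if p: "prime p" "p > max 2 (nat \<bar>lead_coeff r\<bar>)" "p mod n = k" for p
    proof (rule ccontr)
      assume "V p \<noteq> 0"
      then have Vpk: "V p = ev r \<alpha>" and "r \<noteq> 0" using V_mod[of p] p(3) Vk by auto
      obtain H where "G \<circ>\<^sub>p dickson p - G ^ p = of_nat p * H"
        using prime_dvd_pcompose_dickson_diff_power[of p G] p by (auto elim: dvdE)
      then have H: "G \<circ>\<^sub>p dickson p = G ^ p + of_nat p * H" by (simp add: algebra_simps)
      obtain q' s where s: "H = G * q' + s" "s = 0 \<or> degree s < degree G"
        using monic_division_int_poly[OF lead] by blast
      have "p > 0" using p(2) by simp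
      have "V p = real p * ev s \<alpha>"
        unfolding V_def H using s(1) root \<open>p > 0\<close> by (simp add: zero_power)
      \<comment> \<open>\<open>r\<close> and \<open>smult (int p) s\<close> agree at \<alpha> and
        have degree below that of \<open>G\<close>, so they are equal. Then \<open>p\<close> divides
        the leading coefficient of \<open>r\<close>, which is nonzero and smaller than
        \<open>p\<close> in absolute value.\<close>
      then have "ev (r - smult (int p) s) \<alpha> = 0" using Vpk by simp
      moreover have "degree (r - smult (int p) s) < degree G"
        using qr(2) s(2) int_minpoly_degree_pos[OF G] by (intro degree_diff_less) auto
      ultimately have "r - smult (int p) s = 0" using G unfolding int_minpoly_def by fastforce
      then have "lead_coeff r = int p * coeff s (degree r)" by (simp flip: coeff_smult)
      then have "int p dvd \<bar>lead_coeff r\<bar>" by simp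
      then have "int p \<le> \<bar>lead_coeff r\<bar>"
        using \<open>r \<noteq> 0\<close> by (intro zdvd_imp_le) (simp_all add: zero_less_abs_iff)
      then show False using p(2) by linarith
    qed
    then show ?thesis by blast
  qed
  then obtain A where A: "\<And>k p. prime p \<Longrightarrow> p > A k \<Longrightarrow> p mod n = k \<Longrightarrow> V p = 0" by metis
  show ?thesis
  proof (rule that)
    fix p :: nat
    assume p: "prime p" "p > Max (A ` {..<n})"
    then have "p > A (p mod n)" using n by (subst (asm) Max_less_iff) auto
    then show "G dvd G \<circ>\<^sub>p dickson p"
      using A[OF p(1) _ refl] by (simp add: V_def flip: int_minpoly_dvd_iff[OF G])
  qed
qed

text \<open>An elementary stand-in for Dirichlet's theorem: a representative with only large prime
  factors is enough. With \<open>m\<close> the product of the primes up to \<open>A\<close> not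
  dividing \<open>j\<close>, every prime up to \<open>A\<close> divides exactly one of
  \<open>j\<close> and \<open>n * m\<close>, hence not their sum.\<close>

lemma coprime_cong_large_prime_factors:
  fixes j n A :: nat
  assumes "coprime j n" "n > 0"
  obtains m where "j + n * m > 0" "\<And>p. prime p \<Longrightarrow> p dvd j + n * m \<Longrightarrow> p > A"
proof -
  define S where "S = {p. prime p \<and> p \<le> A \<and> \<not> p dvd j}"
  have finS: "finite S" by (rule finite_subset[of _ "{..A}"]) (auto simp: S_def)
  define m where "m = \<Prod>S"
  have m: "m > 0" unfolding m_def using prime_gt_0_nat by (intro prod_pos) (auto simp: S_def)
  have "p > A" if p: "prime p" "p dvd j + n * m" for p
  proof (rule ccontr)
    assume "\<not> p > A"
    show False
    proof (cases "p dvd j")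
      case True
      then have "p dvd n * m" using p by (simp add: dvd_add_right_iff)
      moreover have "\<not> p dvd n" using True assms(1) p(1) by (meson coprime_common_divisor not_prime_unit)
      ultimately have "p dvd m" using p(1) prime_dvd_mult_nat by blast
      then obtain q where "q \<in> S" "p dvd q"
        using p(1) finS unfolding m_def by (auto simp: prime_dvd_prod_iff)
      then have "q = p" using p(1) by (auto simp: S_def intro: primes_dvd_imp_eq[symmetric])
      then show False using \<open>q \<in> S\<close> True by (simp add: S_def)
    next
      case False
      then have "p \<in> S" using p \<open>\<not> p > A\<close> by (simp add: S_def)
      then have "p dvd m" unfolding m_def using finS by (intro dvd_prodI) auto
      then show False using False p(2) by (simp add: dvd_add_left_iff)
    qed
  qed
  then show ?thesis using m assms(2) by (intro that[of m]) auto
qed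

text \<open>\<open>dickson p\<close> multiplies the angle by \<open>p\<close> and, for large primes
  \<open>p\<close>, maps roots of \<open>Psi n\<close> to roots. With \<open>j\<close> replaced by a
  congruent number whose prime factors are all large, the root is reached from the one with
  numerator 1 by finitely many such moves.\<close>

lemma ev_Psi_conjugate:
  assumes n: "n > 0" and j: "coprime j n"
  shows "ev (Psi n) (2 * cos (2 * pi * real j / real n)) = 0"
proof -
  define G where "G = Psi n"
  have G: "int_minpoly G (2 * cos (2 * pi / real n))" unfolding G_def by (rule int_minpoly_Psi[OF n])
  obtain A where A: "\<And>p. prime p \<Longrightarrow> p > A \<Longrightarrow> G dvd G \<circ>\<^sub>p dickson p"
    using minpoly_dvd_pcompose_dickson_large_prime[OF n G] by blast
  have step: "ev G (ev (dickson p) x) = 0" if p: "prime p" "p > A" and x: "ev G x = 0" for p x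
  proof -
    obtain H where "G \<circ>\<^sub>p dickson p = G * H" using A[OF p] by (auto elim: dvdE)
    then have "ev (G \<circ>\<^sub>p dickson p) x = ev (G * H) x" by simp
    then show ?thesis using x by simp
  qed
  have large: "ev G (2 * cos (2 * pi * real i / real n)) = 0"
    if "i > 0" "\<And>p. prime p \<Longrightarrow> p dvd i \<Longrightarrow> p > A" for i
    using that
  proof (induction i rule: less_induct)
    case (less i)
    show ?case
    proof (cases "i = 1")
      case True
      then show ?thesis using G by (simp add: int_minpoly_def)
    next
      case False
      then obtain p where p: "prime p" "p dvd i" using prime_factor_nat by blast
      then obtain k where k: "i = p * k" by (auto elim: dvdE)
      have "k > 0" "k < i" using k less.prems(1) prime_gt_1_nat[OF p(1)] by auto
      then have "ev G (2 * cos (2 * pi * real k / real n)) = 0"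
        using less.IH[of k] less.prems(2) k by simp
      then have "ev G (ev (dickson p) (2 * cos (2 * pi * real k / real n))) = 0"
        using step p less.prems(2) by blast
      then show ?thesis unfolding ev_dickson_two_pi_frac k .
    qed
  qed
  obtain m where "j + n * m > 0" "\<And>p. prime p \<Longrightarrow> p dvd j + n * m \<Longrightarrow> p > A"
    using coprime_cong_large_prime_factors[OF j n] by blast
  from large[OF this] show ?thesis
    unfolding cos_two_pi_frac_add[OF n] G_def .
qed

lemma ev_Psi_div_gcd:
  assumes "N > 0"
  shows "ev (Psi (N div gcd a N)) (2 * cos (2 * pi * real a / real N)) = 0"
proof -
  define g where "g = gcd a N"
  have "g > 0" using assms by (simp add: g_def)
  have a: "a = (a div g) * g" and N: "N = (N div g) * g" by (simp_all add: g_def)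
  have "N div g > 0" using N assms by (cases "N div g") auto
  moreover have "coprime (a div g) (N div g)"
    unfolding g_def using assms by (intro div_gcd_coprime) auto
  ultimately have "ev (Psi (N div g)) (2 * cos (2 * pi * real (a div g) / real (N div g))) = 0"
    by (rule ev_Psi_conjugate)
  moreover have "real a / real N = real (a div g) / real (N div g)"
    using \<open>g > 0\<close> by (simp add: real_of_nat_div g_def)
  ultimately show ?thesis unfolding g_def by (simp only: times_divide_eq_right[symmetric])
qed

section \<open>Divisibility of shifted Dickson polynomials by \<open>Psi m\<close>, and counting of
  roots\<close>

lemma Psi_dvd_dickson_diff_iff:
  assumes "m > 0"
  shows "Psi m dvd dickson n - [:t:] \<longleftrightarrow> 2 * cos (2 * pi * real n / real m) = of_int t"
proof -
  have "ev (dickson n) (2 * cos (2 * pi / real m)) = 2 * cos (2 * pi * real n / real m)"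
    using ev_dickson_two_pi_frac[of n 1 m] by simp
  then show ?thesis by (simp flip: int_minpoly_dvd_iff[OF int_minpoly_Psi[OF assms]])
qed

text \<open>\<open>Psi k\<close> divides \<open>dickson k - [:2:]\<close>, and \<open>Psi i\<close>
  divides this only if \<open>i\<close> divides \<open>k\<close>. Irreducibility makes the given
  divisibility symmetric, so the indices divide each other.\<close>

lemma Psi_dvd_Psi_imp_eq:
  assumes m: "m > 0" and n: "n > 0" and dvd: "Psi m dvd Psi n"
  shows "m = n"
proof -
  have le: "i dvd k" if "i > 0" "k > 0" "Psi i dvd Psi k" for i k
  proof -
    have "Psi k dvd dickson k - [:2:]" using that by (subst Psi_dvd_dickson_diff_iff) simp_all
    then have "Psi i dvd dickson k - [:2:]" using that(3) dvd_trans by blast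
    then show ?thesis using that(1) by (simp add: Psi_dvd_dickson_diff_iff cos_two_pi_frac_eq_1)
  qed
  have "\<not> Psi m dvd 1"
    using int_minpoly_prime_elem[OF int_minpoly_Psi[OF m]] by (simp add: prime_elem_def)
  then have "Psi n dvd Psi m"
    using irreducibleD'[OF int_minpoly_irreducible[OF int_minpoly_Psi[OF n]] dvd] by blast
  then show ?thesis using le dvd m n by (intro dvd_antisym) auto
qed

text \<open>A cosine equal to 1 or -1 at n\<theta> forces sin(n\<theta>) = 0, so the derivative
  vanishes at the root; sin \<theta> is positive because \<open>m > 2\<close>. The derivative of
  \<open>Psi m\<close> has smaller degree than \<open>Psi m\<close> and cannot vanish there, so the
  cofactor does.\<close>

lemma Psi_square_dvd_dickson_diff:
  assumes m: "m > 2" and t: "t = 2 \<or> t = -2" and dvd: "Psi m dvd dickson n - [:t:]"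
  shows "(Psi m)\<^sup>2 dvd dickson n - [:t:]"
proof -
  define \<theta> where "\<theta> = 2 * pi / real m"
  define G where "G = Psi m"
  have G: "int_minpoly G (2 * cos \<theta>)" unfolding G_def \<theta>_def using m by (intro int_minpoly_Psi) simp
  obtain H where H: "dickson n - [:t:] = G * H" using dvd by (auto simp: G_def elim: dvdE)
  have "2 * cos (real n * \<theta>) = of_int t"
    using dvd m by (simp add: Psi_dvd_dickson_diff_iff \<theta>_def mult.commute)
  then have "cos (real n * \<theta>) ^ 2 = 1" using t by auto
  then have "sin (real n * \<theta>) = 0" by (simp add: cos_squared_eq)
  moreover have "sin \<theta> > 0" unfolding \<theta>_def using m by (intro sin_gt_zero) (simp_all add: field_simps)
  ultimately have "ev (pderiv (dickson n)) (2 * cos \<theta>) = 0"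
    using ev_pderiv_dickson[of n \<theta>] by simp
  moreover have "pderiv (dickson n) = pderiv (G * H)" by (simp add: pderiv_diff flip: H)
  ultimately have "ev H (2 * cos \<theta>) * ev (pderiv G) (2 * cos \<theta>) = 0"
    using G by (simp add: pderiv_mult int_minpoly_def)
  moreover have "ev (pderiv G) (2 * cos \<theta>) \<noteq> 0"
  proof
    assume "ev (pderiv G) (2 * cos \<theta>) = 0"
    then have "pderiv G = 0 \<or> degree G \<le> degree (pderiv G)" using G by (simp add: int_minpoly_def)
    then show False using int_minpoly_degree_pos[OF G] by (auto simp: pderiv_eq_0_iff degree_pderiv)
  qed
  ultimately have "G dvd H" by (simp flip: int_minpoly_dvd_iff[OF G])
  then show ?thesis unfolding H by (simp add: power2_eq_square G_def)
qed

text \<open>Distinct indices give primes not dividing one another, hence coprime powers.\<close>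

lemma prod_Psi_power_dvd:
  assumes "finite K" "\<And>k. k \<in> K \<Longrightarrow> k > 0" "\<And>k. k \<in> K \<Longrightarrow> Psi k ^ e k dvd P"
  shows "(\<Prod>k\<in>K. Psi k ^ e k) dvd P"
  using assms
proof (induction K rule: finite_induct)
  case (insert m K)
  have "coprime (Psi m) (Psi k)" if "k \<in> K" for k
  proof (rule prime_elem_imp_coprime)
    have "m > 0" "k > 0" "m \<noteq> k" using that insert.hyps(2) insert.prems(1) by auto
    then show "prime_elem (Psi m)" "\<not> Psi m dvd Psi k"
      using int_minpoly_prime_elem[OF int_minpoly_Psi] Psi_dvd_Psi_imp_eq by blast+
  qed
  then have "coprime (Psi m ^ e m) (\<Prod>k\<in>K. Psi k ^ e k)"
    by (intro prod_coprime_right) simp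
  then show ?case using insert by (simp add: divides_mult)
qed simp

text \<open>The angles lie in [0, pi], where cos is injective, so distinct \<open>a i\<close> yield
  distinct roots.\<close>

lemma le_degree_if_cos_roots:
  assumes "Q \<noteq> 0" "N > 0" "strict_mono a"
    and roots: "\<And>i. i < m \<Longrightarrow> 2 * a i \<le> N \<and> ev Q (2 * cos (2 * pi * real (a i) / real N)) = 0"
  shows "m \<le> degree Q"
proof -
  define r where "r i = 2 * cos (2 * pi * real (a i) / real N)" for i
  have "inj_on r {..<m}"
  proof (rule inj_onI)
    fix i j assume ij: "i \<in> {..<m}" "j \<in> {..<m}" "r i = r j"
    have bound: "2 * pi * real (a i) / real N \<le> pi" if "i < m" for i
    proof -
      have "2 * a i \<le> N" using roots[OF that] by simp
      then have "2 * real (a i) \<le> real N" by linarith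
      then have "pi * (2 * real (a i)) \<le> pi * real N" by (intro mult_left_mono) simp_all
      then show ?thesis using assms(2) by (simp add: pos_divide_le_eq mult_ac)
    qed
    have nonneg: "0 \<le> 2 * pi * real (a i) / real N" for i by simp
    have "cos (2 * pi * real (a i) / real N) = cos (2 * pi * real (a j) / real N)"
      using ij(3) by (simp add: r_def)
    then have "2 * pi * real (a i) / real N = 2 * pi * real (a j) / real N"
      using cos_inj_pi[OF nonneg _ nonneg] bound ij(1,2) by blast
    then have "a i = a j" using assms(2) by simp
    then show "i = j" using strict_mono_eq[OF assms(3)] by blast
  qed
  then have "m = card (r ` {..<m})" by (simp add: card_image)
  also have "\<dots> \<le> card {x. ev Q x = 0}"
    using roots card_roots_ev_le(1)[OF assms(1)] by (intro card_mono) (auto simp: r_def)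
  also have "\<dots> \<le> degree Q" by (rule card_roots_ev_le(2)[OF assms(1)])
  finally show ?thesis .
qed

lemma monic_dvd_degree_le_imp_eq:
  fixes P Q :: "int poly"
  assumes "lead_coeff P = 1" "lead_coeff Q = 1" "Q dvd P" "degree P \<le> degree Q"
  shows "P = Q"
proof -
  obtain H where H: "P = Q * H" using assms(3) by (auto elim: dvdE)
  have "H \<noteq> 0" "Q \<noteq> 0" using assms H by auto
  then have "degree H = 0" using assms(4) by (simp add: H degree_mult_eq)
  then obtain a where a: "H = [:a:]" by (auto elim: degree_eq_zeroE)
  have "lead_coeff Q * lead_coeff H = 1" using assms(1) by (simp add: H lead_coeff_mult)
  then have "a = 1" using assms(2) a by simp
  then show ?thesis using H a by simp
qed

section \<open>Factorization of shifted Dickson polynomials\<close>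

lemma Psi_1: "Psi 1 = [:-2, 1:]"
  and Psi_2: "Psi 2 = [:2, 1:]"
proof -
  have "Psi n = [:a, 1:]" if "n > 0" "ev [:a, 1:] (2 * cos (2 * pi / real n)) = 0" for n a
  proof -
    note G = int_minpoly_Psi[OF that(1)]
    have "Psi n dvd [:a, 1:]" using that(2) by (subst (asm) int_minpoly_dvd_iff[OF G])
    then have "[:a, 1:] = Psi n"
      using G int_minpoly_degree_pos[OF G]
      by (intro monic_dvd_degree_le_imp_eq) (simp_all add: int_minpoly_def)
    then show ?thesis by simp
  qed
  from this[of 1 "-2"] this[of 2 2] show "Psi 1 = [:-2, 1:]" "Psi 2 = [:2, 1:]" by simp_all
qed

lemma lead_coeff_prod_Psi_power:
  assumes "\<And>k. k \<in> K \<Longrightarrow> h k > 0"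
  shows "lead_coeff (\<Prod>k\<in>K. Psi (h k) ^ e k) = 1"
proof -
  have "lead_coeff (Psi (h k)) = 1" if "k \<in> K" for k
    using int_minpoly_Psi[OF assms[OF that]] by (simp add: int_minpoly_def)
  then show ?thesis by (simp add: lead_coeff_prod lead_coeff_power)
qed

text \<open>All angles 2 pi m/d with m coprime to d share one integral value of 2 cos; below, d = 1,
  2, 3, 4, 6 with t = 2, -2, -1, 0, 1. The numbers 2 cos(2 pi a/(d n)) with a coprime to d are then
  roots of \<open>dickson n - [:t:]\<close>.\<close>

locale dickson_level =
  fixes n d :: nat and t :: int
  assumes n_pos: "n > 0" and d_pos: "d > 0"
    and cos_value: "\<And>m. coprime m d \<Longrightarrow> 2 * cos (2 * pi * real m / real d) = of_int t"
begin

text \<open>These are the \<open>k\<close> for which \<open>d * k\<close> is the reduced denominator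
  of some a/(d n) with a coprime to d.\<close>

definition K where "K = {k. k dvd n \<and> coprime (n div k) d}"

lemma finite_K: "finite K"
  unfolding K_def using n_pos by simp

lemma K_pos: "k \<in> K \<Longrightarrow> k > 0"
  unfolding K_def using n_pos by (auto intro: Nat.gr0I)

lemma Psi_dvd:
  assumes "k \<in> K"
  shows "Psi (d * k) dvd dickson n - [:t:]"
proof -
  have "real n = real (n div k) * real k"
    using assms by (simp add: K_def flip: of_nat_mult)
  then have "2 * pi * real n / real (d * k) = 2 * pi * real (n div k) / real d"
    using K_pos[OF assms] by (simp del: of_nat_div)
  then show ?thesis
    using K_pos[OF assms] d_pos cos_value[of "n div k"] assms
    by (subst Psi_dvd_dickson_diff_iff) (simp_all add: K_def del: of_nat_mult)
qed

text \<open>As \<open>a\<close> is coprime to \<open>d\<close>, cancelling in a/(d n) only touches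
  \<open>n\<close>: the reduced denominator is \<open>d * k\<close>.\<close>

lemma root_level:
  assumes "coprime a d"
  defines "k \<equiv> n div gcd a n"
  shows "k \<in> K" "ev (Psi (d * k)) (2 * cos (2 * pi * real a / real (d * n))) = 0"
proof -
  have g: "gcd a (d * n) = gcd a n" using assms(1) by (rule gcd_mult_right_left_cancel)
  have n: "n = k * gcd a n" by (simp add: k_def)
  then have "k > 0" using n_pos by (metis gr0I mult_zero_left)
  then have "n div k = gcd a n" using n by (metis nonzero_mult_div_cancel_left less_numeral_extra(3))
  moreover have "coprime (gcd a n) d" using assms(1) coprime_divisors gcd_dvd1 dvd_refl by blast
  moreover have "k dvd n" using n by (rule dvdI)
  ultimately show "k \<in> K" by (simp add: K_def)
  have "d * n div gcd a (d * n) = d * k" unfolding g k_def by (simp add: div_mult_swap)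
  then show "ev (Psi (d * k)) (2 * cos (2 * pi * real a / real (d * n))) = 0"
    using ev_Psi_div_gcd[of "d * n" a] n_pos d_pos by simp
qed

lemma factorization_power:
  assumes "\<And>k. k \<in> K \<Longrightarrow> Psi (d * k) ^ e k dvd dickson n - [:t:]"
    and "n \<le> degree (\<Prod>k\<in>K. Psi (d * k) ^ e k)"
  shows "dickson n - [:t:] = (\<Prod>k\<in>K. Psi (d * k) ^ e k)"
proof (rule monic_dvd_degree_le_imp_eq)
  \<comment> \<open>Reindexing by m = d k puts the product in the form of
    \<open>prod_Psi_power_dvd\<close>; \<open>m div d\<close> recovers \<open>k\<close> in the
    exponent.\<close>
  have "(\<Prod>k\<in>K. Psi (d * k) ^ e k) = (\<Prod>m\<in>(*) d ` K. Psi m ^ e (m div d))"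
    using d_pos by (subst prod.reindex) (auto intro: inj_onI)
  also have "\<dots> dvd dickson n - [:t:]"
    using finite_K K_pos d_pos assms(1) by (intro prod_Psi_power_dvd) auto
  finally show "(\<Prod>k\<in>K. Psi (d * k) ^ e k) dvd dickson n - [:t:]" .
  show "lead_coeff (\<Prod>k\<in>K. Psi (d * k) ^ e k) = 1"
    using K_pos d_pos by (intro lead_coeff_prod_Psi_power) simp
  show "lead_coeff (dickson n - [:t:]) = 1" by (rule lead_coeff_dickson_diff(2)[OF n_pos])
  show "degree (dickson n - [:t:]) \<le> degree (\<Prod>k\<in>K. Psi (d * k) ^ e k)"
    unfolding lead_coeff_dickson_diff(1)[OF n_pos] by (rule assms(2))
qed

text \<open>The predicate \<open>P\<close> isolates some of the factors, so that roots of those to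
  be squared can be counted alone.\<close>

lemma le_degree_prod_Psi:
  assumes "strict_mono a"
    and a: "\<And>i. i < m \<Longrightarrow> 2 * a i \<le> d * n \<and> coprime (a i) d \<and> P (n div gcd (a i) n)"
  shows "m \<le> degree (\<Prod>k | k \<in> K \<and> P k. Psi (d * k))"
proof (rule le_degree_if_cos_roots[OF _ _ assms(1)])
  have "lead_coeff (\<Prod>k | k \<in> K \<and> P k. Psi (d * k)) = 1"
    using lead_coeff_prod_Psi_power[of "{k \<in> K. P k}" "(*) d" "\<lambda>_. 1"] K_pos d_pos by simp
  then show "(\<Prod>k | k \<in> K \<and> P k. Psi (d * k)) \<noteq> 0" by force
  show "d * n > 0" using n_pos d_pos by simp
  fix i assume i: "i < m"
  have "n div gcd (a i) n \<in> {k \<in> K. P k}" using root_level(1) a[OF i] by simp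
  then have "\<exists>k\<in>{k \<in> K. P k}. ev (Psi (d * k)) (2 * cos (2 * pi * real (a i) / real (d * n))) = 0"
    using root_level(2) a[OF i] by blast
  then have "ev (\<Prod>k | k \<in> K \<and> P k. Psi (d * k)) (2 * cos (2 * pi * real (a i) / real (d * n))) = 0"
    using finite_K unfolding ev_prod by (intro prod_zero) simp_all
  then show "2 * a i \<le> d * n \<and>
      ev (\<Prod>k | k \<in> K \<and> P k. Psi (d * k)) (2 * cos (2 * pi * real (a i) / real (d * n))) = 0"
    using a[OF i] by simp
qed

lemma factorization_squarefree:
  assumes "strict_mono a" "\<And>i. i < n \<Longrightarrow> 2 * a i \<le> d * n \<and> coprime (a i) d"
  shows "dickson n - [:t:] = (\<Prod>k\<in>K. Psi (d * k))"
  using factorization_power[of "\<lambda>_. 1"] Psi_dvd le_degree_prod_Psi[of a n "\<lambda>_. True"] assms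
  by simp

text \<open>Distinct roots of the squared factors count twice in the degree, hence
  \<open>2 * m\<close>. Indices \<open>d * k\<close> of at most 2 belong to \<open>Psi 1\<close> and
  \<open>Psi 2\<close>, whose roots 2 and -2 are treated apart.\<close>

lemma factorization_squares:
  assumes t: "t = 2 \<or> t = -2"
    and a: "strict_mono a"
      "\<And>i. i < m \<Longrightarrow> 2 * a i \<le> d * n \<and> coprime (a i) d \<and> d * (n div gcd (a i) n) > 2"
    and deg: "n \<le> degree (\<Prod>k | k \<in> K \<and> \<not> d * k > 2. Psi (d * k)) + 2 * m"
  shows "dickson n - [:t:] =
    (\<Prod>k | k \<in> K \<and> \<not> d * k > 2. Psi (d * k)) * (\<Prod>k | k \<in> K \<and> d * k > 2. Psi (d * k) ^ 2)"
proof -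
  define e where "e k = (if d * k > 2 then 2 else 1 :: nat)" for k
  define Q1 where "Q1 = (\<Prod>k | k \<in> K \<and> \<not> d * k > 2. Psi (d * k))"
  define Q2 where "Q2 = (\<Prod>k | k \<in> K \<and> d * k > 2. Psi (d * k))"
  have "(\<Prod>k\<in>K. Psi (d * k) ^ e k) =
      (\<Prod>k\<in>K. if d * k > 2 then Psi (d * k) ^ 2 else Psi (d * k))"
    by (rule prod.cong) (simp_all add: e_def)
  also have "\<dots> = (\<Prod>k | k \<in> K \<and> d * k > 2. Psi (d * k) ^ 2) * Q1"
    unfolding Q1_def using finite_K by (subst prod.If_cases) (simp_all add: Collect_conj_eq Collect_neg_eq)
  finally have Q: "(\<Prod>k\<in>K. Psi (d * k) ^ e k) = Q1 * (\<Prod>k | k \<in> K \<and> d * k > 2. Psi (d * k) ^ 2)"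
    by (simp add: mult.commute)
  have monic: "lead_coeff (\<Prod>k | k \<in> K \<and> P k. Psi (d * k)) = 1" for P
    using lead_coeff_prod_Psi_power[of "{k \<in> K. P k}" "(*) d" "\<lambda>_. 1"] K_pos d_pos by simp
  have nz: "Q1 \<noteq> 0" "Q2 \<noteq> 0"
    using monic[of "\<lambda>k. \<not> d * k > 2"] monic[of "\<lambda>k. d * k > 2"] by (force simp: Q1_def Q2_def)+
  have "degree (\<Prod>k\<in>K. Psi (d * k) ^ e k) = degree Q1 + 2 * degree Q2"
    unfolding Q prod_power_distrib[symmetric] Q2_def[symmetric] using nz
    by (simp add: degree_mult_eq degree_power_eq)
  moreover have "m \<le> degree Q2" unfolding Q2_def by (rule le_degree_prod_Psi[OF a])
  ultimately have "n \<le> degree (\<Prod>k\<in>K. Psi (d * k) ^ e k)" using deg by (simp add: Q1_def)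
  moreover have "Psi (d * k) ^ e k dvd dickson n - [:t:]" if "k \<in> K" for k
    using Psi_dvd[OF that] Psi_square_dvd_dickson_diff[OF _ t] by (simp add: e_def)
  ultimately have "dickson n - [:t:] = (\<Prod>k\<in>K. Psi (d * k) ^ e k)"
    by (intro factorization_power)
  then show ?thesis unfolding Q Q1_def .
qed

end

section \<open>The five levels 1, 2, 3, 4 and 6\<close>

lemma coprime_mod_cases:
  fixes m :: nat
  shows "coprime m 2 \<Longrightarrow> m mod 2 = 1"
    and "coprime m 3 \<Longrightarrow> m mod 3 = 1 \<or> m mod 3 = 2"
    and "coprime m 4 \<Longrightarrow> m mod 4 = 1 \<or> m mod 4 = 3"
    and "coprime m 6 \<Longrightarrow> m mod 6 = 1 \<or> m mod 6 = 5"
proof -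
  have 2: "odd m" if "coprime m a" "even a" for a
    using coprime_common_divisor[OF that(1) _ that(2)] by auto
  have 3: "\<not> 3 dvd m" if "coprime m a" "3 dvd a" for a
    using coprime_common_divisor[OF that(1) _ that(2)] by auto
  show "m mod 2 = 1" if "coprime m 2"
    using 2[OF that] by (simp add: odd_iff_mod_2_eq_one)
  show "m mod 3 = 1 \<or> m mod 3 = 2" if "coprime m 3"
    using 3[OF that] by (simp only: dvd_refl) presburger
  show "m mod 4 = 1 \<or> m mod 4 = 3" if "coprime m 4"
    using 2[OF that] by simp presburger
  show "m mod 6 = 1 \<or> m mod 6 = 5" if "coprime m 6"
  proof -
    have "odd m" "\<not> 3 dvd m" using 2[OF that] 3[OF that] by simp_all
    then show ?thesis by presburger
  qed
qed

text \<open>For these \<open>d\<close> the only residues coprime to \<open>d\<close> are 1 and -1,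
  and cos is even.\<close>

lemma two_cos_coprime_values:
  shows "2 * cos (2 * pi * real m / real 1) = of_int 2"
    and "coprime m 2 \<Longrightarrow> 2 * cos (2 * pi * real m / real 2) = of_int (-2)"
    and "coprime m 3 \<Longrightarrow> 2 * cos (2 * pi * real m / real 3) = of_int (-1)"
    and "coprime m 4 \<Longrightarrow> 2 * cos (2 * pi * real m / real 4) = of_int 0"
    and "coprime m 6 \<Longrightarrow> 2 * cos (2 * pi * real m / real 6) = of_int 1"
proof -
  have *: "cos (2 * pi * real m / real d) = cos (2 * pi / real d)"
    if "d > 0" "m mod d = 1 \<or> m mod d = d - 1" for d
  proof -
    have "2 * pi * real (d - 1) / real d = 2 * pi - 2 * pi / real d"
      using that(1) by (simp add: of_nat_diff field_simps)
    then have "cos (2 * pi * real (d - 1) / real d) = cos (2 * pi / real d)" by (simp add: cos_diff)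
    then show ?thesis using cos_two_pi_frac_mod[OF that(1), of m] that(2)
      by (elim disjE) (simp_all only: of_nat_1 mult_1_right)
  qed
  show "2 * cos (2 * pi * real m / real 1) = of_int 2"
    using cos_two_pi_frac_mod[of 1 m] by simp
  show "2 * cos (2 * pi * real m / real 2) = of_int (-2)" if "coprime m 2"
    using *[of 2] coprime_mod_cases(1)[OF that] by simp
  show "2 * cos (2 * pi * real m / real 3) = of_int (-1)" if "coprime m 3"
    using *[of 3] coprime_mod_cases(2)[OF that] cos_120 by simp
  show "2 * cos (2 * pi * real m / real 4) = of_int 0" if "coprime m 4"
    using *[of 4] coprime_mod_cases(3)[OF that] by simp
  show "2 * cos (2 * pi * real m / real 6) = of_int 1" if "coprime m 6"
    using *[of 6] coprime_mod_cases(4)[OF that] cos_60 by simp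
qed

lemma coprime_4_3_6I:
  fixes m :: nat
  shows "odd m \<Longrightarrow> coprime m 4" "\<not> 3 dvd m \<Longrightarrow> coprime m 3"
    "odd m \<Longrightarrow> \<not> 3 dvd m \<Longrightarrow> coprime m 6"
proof -
  have 2: "coprime m 2" if "odd m" using that by simp
  have 3: "coprime m 3" if "\<not> 3 dvd m"
    using that prime_imp_coprime[of 3 m] by (simp add: coprime_commute)
  show "odd m \<Longrightarrow> coprime m 4" using 2 coprime_mult_right_iff[of m 2 2] by simp
  show "\<not> 3 dvd m \<Longrightarrow> coprime m 3" by (rule 3)
  show "odd m \<Longrightarrow> \<not> 3 dvd m \<Longrightarrow> coprime m 6"
    using 2 3 coprime_mult_right_iff[of m 2 3] by simp
qed

lemma coprime_4_iff: "coprime m 4 \<longleftrightarrow> gcd m 2 = 1" for m :: nat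
  using coprime_mult_right_iff[of m 2 2] by (simp add: coprime_iff_gcd_eq_1)

lemma dickson_factorization_0:
  assumes "n > 0"
  shows "dickson n = (\<Prod>k | k dvd n \<and> gcd (n div k) 2 = 1. Psi (4 * k))"
proof -
  interpret dickson_level n 4 0
    by (rule dickson_level.intro[OF assms _ two_cos_coprime_values(4)]) simp_all
  \<comment> \<open>The numerators over 4n are the odd numbers below 2n.\<close>
  have "dickson n - [:0:] = (\<Prod>k\<in>K. Psi (4 * k))"
    by (rule factorization_squarefree[of "\<lambda>i. 2 * i + 1"])
       (auto simp: strict_mono_def intro!: coprime_4_3_6I)
  then show ?thesis by (simp add: K_def coprime_4_iff)
qed

lemma not_3_dvd_add_Suc_mod_2: "\<not> 3 dvd 3 * k + (1 + i mod 2)" for i k :: nat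
proof -
  have "\<not> (3::nat) dvd 1" "\<not> (3::nat) dvd 1 + 1" by presburger+
  then have "\<not> 3 dvd 1 + i mod 2" by (cases "even i") (simp_all add: odd_iff_mod_2_eq_one)
  then show ?thesis by (metis dvd_add_right_iff dvd_triv_left)
qed

lemma dickson_factorization_1:
  assumes "n > 0"
  shows "dickson n - [:1:] = (\<Prod>k | k dvd n \<and> gcd (n div k) 6 = 1. Psi (6 * k))"
proof -
  interpret dickson_level n 6 1
    by (rule dickson_level.intro[OF assms _ two_cos_coprime_values(5)]) simp_all
  \<comment> \<open>1, 5, 7, 11, ...: the numbers coprime to 6, one strictly between 3i and 3(i + 1)
    for each i, so that the first n lie below 3n.\<close>
  define a where "a i = 3 * i + (1 + i mod 2)" for i :: nat
  have a: "3 * i < a i \<and> a i < 3 * Suc i" for i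
  proof -
    have "i mod 2 < 2" by simp
    then show ?thesis unfolding a_def by (simp del: mod_less_divisor)
  qed
  have "dickson n - [:1:] = (\<Prod>k\<in>K. Psi (6 * k))"
  proof (rule factorization_squarefree)
    show "strict_mono a"
      unfolding strict_mono_Suc_iff using a less_trans by blast
    fix i assume "i < n"
    then have "2 * a i \<le> 6 * n" using a[of i] by presburger
    moreover have "odd (a i)"
      by (cases "even i") (simp_all add: a_def odd_iff_mod_2_eq_one)
    moreover have "\<not> 3 dvd a i" unfolding a_def by (rule not_3_dvd_add_Suc_mod_2)
    ultimately show "2 * a i \<le> 6 * n \<and> coprime (a i) 6"
      using coprime_4_3_6I(3) by blast
  qed
  then show ?thesis by (simp only: K_def coprime_iff_gcd_eq_1)
qed

lemma dickson_factorization_minus_1: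
  assumes "n > 0"
  shows "dickson n - [:-1:] = (\<Prod>k | k dvd n \<and> gcd (n div k) 3 = 1. Psi (3 * k))"
proof -
  interpret dickson_level n 3 "-1"
    by (rule dickson_level.intro[OF assms _ two_cos_coprime_values(3)]) simp_all
  \<comment> \<open>1, 2, 4, 5, 7, ...: the numbers not divisible by 3. This form gives growth and
    the bound 3n/2, the next one the residue modulo 3.\<close>
  define a where "a i = i + 1 + i div 2" for i :: nat
  have a: "a i = 3 * (i div 2) + (1 + i mod 2)" for i
    using div_mult_mod_eq[of i 2] unfolding a_def by linarith
  have "dickson n - [:-1:] = (\<Prod>k\<in>K. Psi (3 * k))"
  proof (rule factorization_squarefree)
    show "strict_mono a"
      unfolding strict_mono_Suc_iff a_def by (simp add: div_le_mono le_imp_less_Suc)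
    fix i assume "i < n"
    moreover have "2 * (i div 2) \<le> i" by simp
    ultimately have "2 * a i \<le> 3 * n" unfolding a_def distrib_left by linarith
    moreover have "\<not> 3 dvd a i" unfolding a by (rule not_3_dvd_add_Suc_mod_2)
    ultimately show "2 * a i \<le> 3 * n \<and> coprime (a i) 3"
      using coprime_4_3_6I(2) by blast
  qed
  then show ?thesis by (simp only: K_def coprime_iff_gcd_eq_1)
qed

lemma dickson_factorization_2:
  assumes "n > 0"
  shows "dickson n - [:2:] =
    (if odd n then [:-2, 1:] else [:-2, 1:] * [:2, 1:]) * (\<Prod>k | k dvd n \<and> 2 < k. Psi k ^ 2)"
proof -
  interpret dickson_level n 1 2
    by (rule dickson_level.intro[OF assms _ two_cos_coprime_values(1)]) simp_all
  have K: "K = {k. k dvd n}" unfolding K_def by simp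
  have small: "{k. k \<in> K \<and> \<not> 1 * k > 2} = (if odd n then {1} else {1, 2})"
  proof (intro set_eqI)
    fix k
    have "k dvd n \<Longrightarrow> k > 0" using assms by (auto intro: Nat.gr0I)
    moreover have "k > 0 \<Longrightarrow> \<not> k > 2 \<Longrightarrow> k = 1 \<or> k = 2" by linarith
    ultimately show "k \<in> {k. k \<in> K \<and> \<not> 1 * k > 2} \<longleftrightarrow> k \<in> (if odd n then {1} else {1, 2})"
      unfolding K by auto
  qed
  have Q1: "(\<Prod>k | k \<in> K \<and> \<not> 1 * k > 2. Psi (1 * k)) =
      (if odd n then [:-2, 1:] else [:-2, 1:] * [:2, 1:])"
    unfolding small by (simp add: Psi_1[simplified] Psi_2)
  have "dickson n - [:2:] =
    (\<Prod>k | k \<in> K \<and> \<not> 1 * k > 2. Psi (1 * k)) * (\<Prod>k | k \<in> K \<and> 1 * k > 2. Psi (1 * k) ^ 2)"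
  \<comment> \<open>The numerators \<open>Suc i\<close> with \<open>2 * Suc i < n\<close> are those
    of angles strictly between 0 and pi; the ends, with roots 2 and -2, are left to the unsquared
    factors.\<close>
  proof (rule factorization_squares[of Suc "(n - 1) div 2"])
    fix i assume "i < (n - 1) div 2"
    then have i: "2 * Suc i < n" by presburger
    define g where "g = gcd (Suc i) n"
    obtain u v where u: "Suc i = g * u" and v: "n = g * v"
      unfolding g_def by (meson dvdE gcd_dvd1 gcd_dvd2)
    have "g > 0" by (simp add: g_def)
    have "u > 0" using u by (cases u) auto
    \<comment> \<open>In lowest terms the fraction is u/v with 0 < 2u < v, which forces v >
      2.\<close>
    have "g * (2 * u) < g * v" using i u v by (metis mult.left_commute)
    then have "v > 2" using \<open>u > 0\<close> by auto
    moreover have "n div g = v" using v \<open>g > 0\<close> by simp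
    ultimately show "2 * Suc i \<le> 1 * n \<and> coprime (Suc i) 1 \<and> 1 * (n div gcd (Suc i) n) > 2"
      using i by (simp add: g_def)
  next
    show "n \<le> degree (\<Prod>k | k \<in> K \<and> \<not> 1 * k > 2. Psi (1 * k)) + 2 * ((n - 1) div 2)"
      unfolding Q1 using assms by (cases "odd n") (simp_all; presburger)+
  qed (simp_all add: strict_mono_Suc_iff)
  then show ?thesis unfolding Q1 unfolding K by simp
qed

lemma dickson_factorization_minus_2:
  assumes "n > 0"
  shows "dickson n - [:-2:] = (if odd n then [:2, 1:] else 1) *
    (\<Prod>k | k dvd n \<and> 1 < k \<and> gcd (n div k) 2 = 1. Psi (2 * k) ^ 2)"
proof -
  interpret dickson_level n 2 "-2"
    by (rule dickson_level.intro[OF assms _ two_cos_coprime_values(2)]) simp_all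
  have small: "{k. k \<in> K \<and> \<not> 2 * k > 2} = (if odd n then {1} else {})"
    using K_pos by (auto simp: K_def not_less le_Suc_eq)
  have Q1: "(\<Prod>k | k \<in> K \<and> \<not> 2 * k > 2. Psi (2 * k)) = (if odd n then [:2, 1:] else 1)"
    unfolding small by (simp add: Psi_2)
  have "dickson n - [:-2:] =
    (\<Prod>k | k \<in> K \<and> \<not> 2 * k > 2. Psi (2 * k)) * (\<Prod>k | k \<in> K \<and> 2 * k > 2. Psi (2 * k) ^ 2)"
  \<comment> \<open>The numerators over 2n are the odd numbers below \<open>n\<close>; if
    \<open>n\<close> is odd, the numerator \<open>n\<close> itself gives the simple root -2.\<close>
  proof (rule factorization_squares[of "\<lambda>i. 2 * i + 1" "n div 2"])
    fix i assume "i < n div 2"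
    then have i: "2 * i + 1 < n" by linarith
    define g where "g = gcd (2 * i + 1) n"
    have "g \<le> 2 * i + 1" unfolding g_def by (intro dvd_imp_le) auto
    then have "g < n" using i by linarith
    moreover obtain v where v: "n = g * v" unfolding g_def by (meson dvdE gcd_dvd2)
    ultimately have "v > 1" using assms by (cases "v = 0 \<or> v = 1") auto
    moreover have "n div g = v" using v assms by (cases "g = 0") auto
    ultimately show "2 * (2 * i + 1) \<le> 2 * n \<and> coprime (2 * i + 1) 2 \<and>
        2 * (n div gcd (2 * i + 1) n) > 2"
      using i by (simp add: g_def)
  next
    show "n \<le> degree (\<Prod>k | k \<in> K \<and> \<not> 2 * k > 2. Psi (2 * k)) + 2 * (n div 2)"
      unfolding Q1 by (cases "odd n") (simp_all; presburger)+
  qed (simp_all add: strict_mono_Suc_iff)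
  moreover have "{k. k \<in> K \<and> 2 * k > 2} = {k. k dvd n \<and> 1 < k \<and> gcd (n div k) 2 = 1}"
    by (auto simp: K_def coprime_iff_gcd_eq_1)
  ultimately show ?thesis unfolding Q1 by simp
qed

lemma irreducible_Psi_shift:
  assumes "n > 0"
  shows "irreducible (Psi n \<circ>\<^sub>p [:a, 1:])"
  using int_minpoly_irreducible[OF int_minpoly_shift[OF int_minpoly_Psi[OF assms]]] .

text \<open>\<open>Psi 1\<close> is X - 2, so X + a is its translate by a + 2.\<close>

lemma irreducible_monic_linear: "irreducible [:a, 1 :: int:]"
  using irreducible_Psi_shift[of 1 "a + 2"] by (simp add: Psi_1[simplified] pcompose_pCons)

theorem theorem2p13:
  fixes b :: rat and n :: nat
  assumes "b \<in> {0, 1, -1, 1/2, -1/2}" and "n > 0"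
  shows
    "(b = 0 \<longrightarrow>
        f b n = map_poly of_int (\<Prod>k | k dvd n \<and> gcd (n div k) 2 = 1. Psi (4 * k)) \<and>
        (\<forall>k. k dvd n \<and> gcd (n div k) 2 = 1 \<longrightarrow> irreducible (Psi (4 * k)))) \<and>
     (b = 1 \<longrightarrow>
        f b n = map_poly of_int (c n * (\<Prod>k | k dvd n \<and> 2 < k. (Psi k \<circ>\<^sub>p [:2, 1:]) ^ 2)) \<and>
        irreducible [:0, 1 :: int:] \<and> irreducible [:4, 1 :: int:] \<and>
        (\<forall>k. k dvd n \<and> 2 < k \<longrightarrow> irreducible (Psi k \<circ>\<^sub>p [:2, 1:]))) \<and>
     (b = -1 \<longrightarrow>
        f b n = map_poly of_int (c_star n *
          (\<Prod>k | k dvd n \<and> 1 < k \<and> gcd (n div k) 2 = 1. (Psi (2 * k) \<circ>\<^sub>p [:-2, 1:]) ^ 2)) \<and>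
        irreducible [:0, 1 :: int:] \<and>
        (\<forall>k. k dvd n \<and> 1 < k \<and> gcd (n div k) 2 = 1 \<longrightarrow>
          irreducible (Psi (2 * k) \<circ>\<^sub>p [:-2, 1:]))) \<and>
     (b = 1/2 \<longrightarrow>
        f b n = map_poly of_int
          (\<Prod>k | k dvd n \<and> gcd (n div k) 6 = 1. Psi (6 * k) \<circ>\<^sub>p [:1, 1:]) \<and>
        (\<forall>k. k dvd n \<and> gcd (n div k) 6 = 1 \<longrightarrow> irreducible (Psi (6 * k) \<circ>\<^sub>p [:1, 1:]))) \<and>
     (b = -1/2 \<longrightarrow>
        f b n = map_poly of_int
          (\<Prod>k | k dvd n \<and> gcd (n div k) 3 = 1. Psi (3 * k) \<circ>\<^sub>p [:-1, 1:]) \<and>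
        (\<forall>k. k dvd n \<and> gcd (n div k) 3 = 1 \<longrightarrow> irreducible (Psi (3 * k) \<circ>\<^sub>p [:-1, 1:])))"
proof -
  have pos: "k > 0" if "k dvd n" for k using that assms(2) by (auto intro: Nat.gr0I)
  have shift: "f b n = map_poly of_int (P \<circ>\<^sub>p [:t, 1:])"
    if "2 * b = of_int t" "dickson n - [:t:] = P" for t P
    using f_eq_dickson[OF that(1)] that(2) by simp
  have case_0: "f b n = map_poly of_int (\<Prod>k | k dvd n \<and> gcd (n div k) 2 = 1. Psi (4 * k))"
    if "b = 0"
    using shift[of 0] dickson_factorization_0[OF assms(2)] that by simp
  have case_1: "f b n = map_poly of_int (c n * (\<Prod>k | k dvd n \<and> 2 < k. (Psi k \<circ>\<^sub>p [:2, 1:]) ^ 2))"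
    if "b = 1"
  proof -
    have "2 * b = of_int 2" using that by simp
    \<comment> \<open>Substituting X + 2 turns X - 2 into X and X + 2 into X + 4, which gives
      \<open>c n\<close>.\<close>
    from shift[OF this dickson_factorization_2[OF assms(2)]] show ?thesis
      by (simp add: c_def pcompose_mult pcompose_prod power2_eq_square pcompose_pCons)
  qed
  have case_2: "f b n = map_poly of_int (c_star n *
      (\<Prod>k | k dvd n \<and> 1 < k \<and> gcd (n div k) 2 = 1. (Psi (2 * k) \<circ>\<^sub>p [:-2, 1:]) ^ 2))"
    if "b = -1"
  proof -
    have "2 * b = of_int (-2)" using that by simp
    \<comment> \<open>Substituting X - 2 turns X + 2 into X, which gives
      \<open>c_star n\<close>.\<close>
    from shift[OF this dickson_factorization_minus_2[OF assms(2)]] show ?thesis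
      by (simp add: c_star_def pcompose_mult pcompose_prod power2_eq_square pcompose_pCons pcompose_1)
  qed
  have case_3: "f b n = map_poly of_int
      (\<Prod>k | k dvd n \<and> gcd (n div k) 6 = 1. Psi (6 * k) \<circ>\<^sub>p [:1, 1:])"
    if "b = 1/2"
  proof -
    have "2 * b = of_int 1" using that by simp
    from shift[OF this dickson_factorization_1[OF assms(2)]] show ?thesis by (simp only: pcompose_prod)
  qed
  have case_4: "f b n = map_poly of_int
      (\<Prod>k | k dvd n \<and> gcd (n div k) 3 = 1. Psi (3 * k) \<circ>\<^sub>p [:-1, 1:])"
    if "b = -1/2"
  proof -
    have "2 * b = of_int (-1)" using that by simp
    from shift[OF this dickson_factorization_minus_1[OF assms(2)]] show ?thesis by (simp only: pcompose_prod)
  qed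
  have irr: "irreducible (Psi (d * k))" if "d > 0" "k dvd n" for d k
    using irreducible_Psi_shift[of "d * k" 0] that pos by simp
  show ?thesis
    by (intro conjI impI allI case_0 case_1 case_2 case_3 case_4 irreducible_monic_linear
        irreducible_Psi_shift irr) (auto intro: pos)
qed

end
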